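(* Let $G$ be a simple mixed graph on $n$ vertices. Then $\boldsymbol{\xi}_1(G)+\boldsymbol{\xi}_{2n}(G)\leq 2\xi_1(G_u)+\max_{u\in V_G}d^+(u)+\max_{u\in V_G}d^-(u)$, where $\boldsymbol{\xi}_1(G)$ and $\boldsymbol{\xi}_{2n}(G)$ are the largest and smallest eigenvalues of the integrated signless Laplacian matrix of $G$, and $\xi_1(G_u)$ is the largest eigenvalue of the signless Laplacian matrix $Q(G_u)=D(G_u)+A(G_u)$ of the undirected part $G_u$ of $G$.
   Context: A mixed graph $G$ has a finite vertex set $V_G$, a multiset $E_G$ of edges (unordered pairs) and a multiset $\vec{E}_G$ of arcs (ordered pairs); it is simple if it has no loops, directed loops, multiple edges or multiple arcs. The undirected part $G_u$ is the graph $(V_G,E_G)$, with degree matrix $D(G_u)$ and adjacency matrix $A(G_u)$. $d(v)$ is the number of edges at $v$; $d^+(v)$ (resp. $d^-(v)$) is the number of arcs starting (resp. ending) at $v$. For $V_G=\{v_1,\dots,v_n\}$, the integrated adjacency matrix $\mathcal{I}(G)$ is the $2n\times 2n$ matrix indexed by $v'_1,\dots,v'_n,v''_1,\dots,v''_n$ whose $(v'_i,v'_j)$ and $(v''_i,v''_j)$ entries are the number of edges joining $v_i,v_j$ and whose $(v'_i,v''_j)$ and $(v''_j,v'_i)$ entries are the number of arcs from $v_i$ to $v_j$. The integrated degree matrix $\mathcal{I}^D(G)$ is diagonal with $(v'_i,v'_i)$ entry $d(v_i)+d^+(v_i)$ and $(v''_i,v''_i)$ entry $d(v_i)+d^-(v_i)$;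 the integrated signless Laplacian matrix is $\mathcal{I}^Q(G)=\mathcal{I}^D(G)+\mathcal{I}(G)$. *)

theory Defs
  imports "HOL-Library.Multiset" "HOL-Library.Uprod" "Jordan_Normal_Form.Spectral_Radius"
begin

record 'v multigraph =
  verts :: "'v set"
  edges :: "'v uprod multiset"

record 'v mixed_graph = "'v multigraph" +
  arcs :: "('v \<times> 'v) multiset"

definition mixed_graph :: "'v mixed_graph \<Rightarrow> bool" where
  "mixed_graph G \<longleftrightarrow> finite (verts G) \<and>
     (\<forall>e \<in># edges G. set_uprod e \<subseteq> verts G) \<and>
     set_mset (arcs G) \<subseteq> verts G \<times> verts G"

text \<open>An edge and an arc may join the same two vertices of a simple mixed graph, and so may
  two arcs of opposite direction: those are different unordered or ordered pairs.\<close>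

definition simple_mixed_graph :: "'v mixed_graph \<Rightarrow> bool" where
  "simple_mixed_graph G \<longleftrightarrow> mixed_graph G \<and>
     (\<forall>v. Upair v v \<notin># edges G) \<and> (\<forall>v. (v, v) \<notin># arcs G) \<and>
     (\<forall>e. count (edges G) e \<le> 1) \<and> (\<forall>a. count (arcs G) a \<le> 1)"

definition undirected_part :: "'v mixed_graph \<Rightarrow> 'v multigraph" where
  "undirected_part G = multigraph.truncate G"

definition deg :: "('v, 'b) multigraph_scheme \<Rightarrow> 'v \<Rightarrow> nat" where
  "deg G v = size {#e \<in># edges G. v \<in> set_uprod e#}"

definition out_deg :: "'v mixed_graph \<Rightarrow> 'v \<Rightarrow> nat" where
  "out_deg G v = size {#a \<in># arcs G. fst a = v#}"

definition in_deg :: "'v mixed_graph \<Rightarrow> 'v \<Rightarrow> nat" where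
  "in_deg G v = size {#a \<in># arcs G. snd a = v#}"

text \<open>The matrices are taken with respect to an enumeration \<open>vs\<close> of the vertices.\<close>

definition adjacency_mat :: "('v, 'b) multigraph_scheme \<Rightarrow> 'v list \<Rightarrow> real mat" where
  "adjacency_mat G vs = mat (length vs) (length vs)
     (\<lambda>(i, j). real (count (edges G) (Upair (vs ! i) (vs ! j))))"

definition degree_mat :: "('v, 'b) multigraph_scheme \<Rightarrow> 'v list \<Rightarrow> real mat" where
  "degree_mat G vs = mat_diag (length vs) (\<lambda>i. real (deg G (vs ! i)))"

definition signless_laplacian :: "('v, 'b) multigraph_scheme \<Rightarrow> 'v list \<Rightarrow> real mat" where
  "signless_laplacian G vs = degree_mat G vs + adjacency_mat G vs"

definition arc_mat :: "'v mixed_graph \<Rightarrow> 'v list \<Rightarrow> real mat" where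
  "arc_mat G vs = mat (length vs) (length vs)
     (\<lambda>(i, j). real (count (arcs G) (vs ! i, vs ! j)))"

text \<open>In the integrated matrices of a mixed graph with \<open>n\<close> vertices, the indices
  \<open>0, \<dots>, n - 1\<close> stand for the first copies \<open>v'\<close> of the vertices and \<open>n, \<dots>, 2n - 1\<close> for the
  second copies \<open>v''\<close>.\<close>

definition integrated_adjacency_mat :: "'v mixed_graph \<Rightarrow> 'v list \<Rightarrow> real mat" where
  "integrated_adjacency_mat G vs =
     four_block_mat (adjacency_mat G vs) (arc_mat G vs)
                    (transpose_mat (arc_mat G vs)) (adjacency_mat G vs)"

definition integrated_degree_mat :: "'v mixed_graph \<Rightarrow> 'v list \<Rightarrow> real mat" where
  "integrated_degree_mat G vs = (let n = length vs in
     four_block_mat (mat_diag n (\<lambda>i. real (deg G (vs ! i) + out_deg G (vs ! i)))) (0\<^sub>m n n)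
                    (0\<^sub>m n n) (mat_diag n (\<lambda>i. real (deg G (vs ! i) + in_deg G (vs ! i)))))"

definition integrated_signless_laplacian :: "'v mixed_graph \<Rightarrow> 'v list \<Rightarrow> real mat" where
  "integrated_signless_laplacian G vs = integrated_degree_mat G vs + integrated_adjacency_mat G vs"

text \<open>Used only for real symmetric matrices of positive dimension, whose (real) spectrum is
  finite and nonempty, so that the maximum and the minimum exist.\<close>

definition largest_eigenvalue :: "real mat \<Rightarrow> real" where
  "largest_eigenvalue M = Max (spectrum M)"

definition smallest_eigenvalue :: "real mat \<Rightarrow> real" where
  "smallest_eigenvalue M = Min (spectrum M)"

end

theory Submission
  imports Defs "HOL-Analysis.Function_Topology"
begin

text \<open>The integrated signless Laplacian has diagonal blocks \<open>Q + D\<^sup>+\<close> and \<open>Q + D\<^sup>-\<close>, where \<open>Q\<close> is the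
  signless Laplacian of the undirected part. For any symmetric 2 by 2 block matrix, the sum of the
  two extreme eigenvalues is at most the sum of the largest eigenvalues of the diagonal blocks, and
  adding a diagonal matrix to \<open>Q\<close> raises the largest eigenvalue by at most its largest entry.\<close>

section \<open>Maxima of quadratic forms on the unit sphere\<close>

lemma scalar_prod_self_nonneg:
  fixes v :: "real vec"
  shows "0 \<le> v \<bullet> v"
  by (simp add: scalar_prod_def sum_nonneg)

lemma scalar_prod_self_eq_0:
  fixes v :: "real vec"
  assumes "v \<bullet> v = 0"
  shows "v = 0\<^sub>v (dim_vec v)"
  using assms by (intro eq_vecI) (auto simp: scalar_prod_def sum_nonneg_eq_0_iff)

text \<open>Compactness of the sphere: vectors are replaced by functions on \<open>nat\<close> that
  vanish from \<open>n\<close> on, so that the sphere is a closed subset of a product of compact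
  sets, and the form is a polynomial in finitely many coordinates.\<close>

lemma quadratic_form_attains_max:
  fixes A :: "real mat"
  assumes A: "A \<in> carrier_mat n n" and n: "0 < n"
  obtains v where "v \<in> carrier_vec n" "v \<bullet> v = 1"
    "\<And>w. w \<in> carrier_vec n \<Longrightarrow> w \<bullet> w = 1 \<Longrightarrow> w \<bullet> (A *\<^sub>v w) \<le> v \<bullet> (A *\<^sub>v v)"
proof -
  \<comment> \<open>The product runs over all of \<open>nat\<close>; pinning the surplus coordinates
    to 0 makes every factor compact.\<close>
  define S :: "nat \<Rightarrow> real set" where "S i = (if i < n then {-1..1} else {0})" for i
  define K where "K = PiE UNIV S \<inter> {f. (\<Sum>i<n. f i * f i) = 1}"
  define F where "F f = (\<Sum>i<n. \<Sum>j<n. f i * (A $$ (i, j) * f j))" for f :: "nat \<Rightarrow> real"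
  have F: "vec n f \<bullet> (A *\<^sub>v vec n f) = F f" for f
    using A by (simp add: F_def scalar_prod_def mult_mat_vec_def sum_distrib_left atLeast0LessThan)
  have sq: "vec n f \<bullet> vec n f = (\<Sum>i<n. f i * f i)" for f :: "nat \<Rightarrow> real"
    by (simp add: scalar_prod_def atLeast0LessThan)
  have coord: "continuous_on UNIV (\<lambda>f :: nat \<Rightarrow> real. f i)" for i
    by (rule continuous_on_product_coordinates)
  have "compactin (product_topology (\<lambda>_. euclidean) UNIV) (PiE UNIV S)"
    by (subst compactin_PiE) (auto simp: S_def)
  then have "compact (PiE UNIV S)"
    by (simp add: euclidean_product_topology)
  moreover have "closed {f :: nat \<Rightarrow> real. (\<Sum>i<n. f i * f i) = 1}"
    by (intro closed_Collect_eq continuous_intros coord)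
  ultimately have compact: "compact K"
    unfolding K_def by (rule compact_Int_closed)
  \<comment> \<open>The first standard basis vector, which exists because
    \<open>0 < n\<close>.\<close>
  have "(\<lambda>i. if i = 0 then 1 else 0) \<in> K"
    using n by (auto simp: K_def S_def if_distrib cong: if_cong)
  then have "K \<noteq> {}" by blast
  have cont: "continuous_on K F"
    unfolding F_def
    by (intro continuous_intros continuous_on_subset[OF coord]) auto
  obtain f where f: "f \<in> K" and max: "\<And>g. g \<in> K \<Longrightarrow> F g \<le> F f"
    using continuous_attains_sup[OF compact \<open>K \<noteq> {}\<close> cont] by blast
  show thesis
  proof (rule that[of "vec n f"])
    show "vec n f \<bullet> vec n f = 1"
      using f by (simp add: K_def sq)
    fix w :: "real vec"
    assume w: "w \<in> carrier_vec n" and norm: "w \<bullet> w = 1"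
    define g where "g i = (if i < n then w $ i else 0)" for i
    have wg: "w = vec n g"
      using w by (intro eq_vecI) (auto simp: g_def)
    have g1: "(\<Sum>i<n. g i * g i) = 1"
      using norm unfolding wg sq .
    \<comment> \<open>The box cuts off no unit vector: each squared coordinate is at most the whole
      sum 1.\<close>
    have "g i \<in> {-1..1}" if "i < n" for i
    proof -
      have "g i * g i \<le> (\<Sum>i<n. g i * g i)"
        using that by (intro member_le_sum) auto
      then show ?thesis
        using g1 abs_le_square_iff[of "g i" 1] by (auto simp: power2_eq_square abs_le_iff)
    qed
    then have "g \<in> K"
      using g1 by (auto simp: K_def S_def g_def)
    then show "w \<bullet> (A *\<^sub>v w) \<le> vec n f \<bullet> (A *\<^sub>v vec n f)"
      unfolding wg F by (rule max)
  qed simp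
qed

section \<open>Extreme eigenvalues of real symmetric matrices\<close>

lemma symmetric_mat_scalar_prod:
  fixes A :: "'a :: comm_semiring_0 mat"
  assumes "A \<in> carrier_mat n n" "A\<^sup>T = A" "v \<in> carrier_vec n" "w \<in> carrier_vec n"
  shows "v \<bullet> (A *\<^sub>v w) = w \<bullet> (A *\<^sub>v v)"
  using transpose_vec_mult_scalar[of A n n w v] assms
    comm_scalar_prod[of w n "A *\<^sub>v v"] by simp

text \<open>Perturb \<open>v\<close> in the direction \<open>h = A *\<^sub>v v\<close>: the form at
  \<open>v + t \<cdot>\<^sub>v h\<close> has linear term \<open>2 * t * (h \<bullet> h)\<close>, so
  it would become negative for small negative \<open>t\<close> unless \<open>h\<close>
  vanishes.\<close>

lemma psd_quadratic_form_eq_0: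
  fixes A :: "real mat"
  assumes A: "A \<in> carrier_mat n n" and sym: "A\<^sup>T = A"
    and psd: "\<And>w. w \<in> carrier_vec n \<Longrightarrow> 0 \<le> w \<bullet> (A *\<^sub>v w)"
    and v: "v \<in> carrier_vec n" and zero: "v \<bullet> (A *\<^sub>v v) = 0"
  shows "A *\<^sub>v v = 0\<^sub>v n"
proof -
  define h where "h = A *\<^sub>v v"
  have h: "h \<in> carrier_vec n" and Ah: "A *\<^sub>v h \<in> carrier_vec n"
    using A v by (auto simp: h_def)
  have quad: "0 \<le> 2 * t * (h \<bullet> h) + t * t * (h \<bullet> (A *\<^sub>v h))" for t
  proof -
    have "(v + t \<cdot>\<^sub>v h) \<bullet> (A *\<^sub>v (v + t \<cdot>\<^sub>v h))
        = (v + t \<cdot>\<^sub>v h) \<bullet> (h + t \<cdot>\<^sub>v (A *\<^sub>v h))"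
      using A v h by (simp add: mult_add_distrib_mat_vec mult_mat_vec h_def)
    also have "\<dots> = v \<bullet> h + t * (v \<bullet> (A *\<^sub>v h)) + (t * (h \<bullet> h) + t * (t * (h \<bullet> (A *\<^sub>v h))))"
      using v h Ah
      by (simp add: add_scalar_prod_distrib[of _ n] scalar_prod_add_distrib[of _ n])
    also have "v \<bullet> (A *\<^sub>v h) = h \<bullet> h"
      using symmetric_mat_scalar_prod[OF A sym v h] by (simp add: h_def)
    also have "v \<bullet> h = 0"
      using zero by (simp add: h_def)
    finally show ?thesis
      using psd[of "v + t \<cdot>\<^sub>v h"] v h by (simp add: algebra_simps)
  qed
  have "h \<bullet> h = 0"
  proof (rule ccontr)
    define a b where "a = h \<bullet> h" and "b = h \<bullet> (A *\<^sub>v h)"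
    assume "h \<bullet> h \<noteq> 0"
    then have "0 < a"
      using scalar_prod_self_nonneg[of h] by (simp add: a_def)
    have "0 \<le> b"
      using psd[OF h] by (simp add: b_def)
    \<comment> \<open>The summand 1 keeps the denominator positive when \<open>b = 0\<close>. Since
      \<open>t * b = - a - t\<close>, the factor \<open>2 * a + t * b\<close> equals
      \<open>a - t\<close>, which is positive.\<close>
    define t where "t = - (a / (b + 1))"
    have "t < 0" "t * (b + 1) = - a"
      using \<open>0 < a\<close> \<open>0 \<le> b\<close> by (auto simp: t_def)
    then have "2 * a + t * b > 0"
      using \<open>0 < a\<close> by (simp add: algebra_simps)
    then have "t * (2 * a + t * b) < 0"
      using \<open>t < 0\<close> by (simp add: mult_neg_pos)
    then show False
      using quad[of t] by (simp add: a_def b_def algebra_simps)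
  qed
  then have "h = 0\<^sub>v n"
    using scalar_prod_self_eq_0[of h] h by (metis carrier_vecD)
  then show ?thesis
    by (simp add: h_def)
qed

lemma mat_diag_mult_vec:
  fixes f :: "nat \<Rightarrow> 'a :: semiring_0"
  assumes "v \<in> carrier_vec n"
  shows "mat_diag n f *\<^sub>v v = vec n (\<lambda>i. f i * v $ i)"
proof (intro eq_vecI)
  fix i assume "i < dim_vec (vec n (\<lambda>i. f i * v $ i))"
  then have i: "i < n" by simp
  then have "(mat_diag n f *\<^sub>v v) $ i = (\<Sum>j = 0..<n. (if i = j then f j else 0) * v $ j)"
    using assms by (simp add: mat_diag_def scalar_prod_def)
  also have "\<dots> = (\<Sum>j = 0..<n. if i = j then f j * v $ j else 0)"
    by (intro sum.cong) auto
  finally show "(mat_diag n f *\<^sub>v v) $ i = vec n (\<lambda>i. f i * v $ i) $ i"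
    using i by simp
qed (simp add: mat_diag_def)

text \<open>Take \<open>k\<close> to be the maximum of the form on the unit sphere. Then
  \<open>k\<close> times the identity minus \<open>A\<close> is positive semidefinite, and its form
  vanishes at the maximizer, which therefore lies in its kernel and is an eigenvector of
  \<open>A\<close>.\<close>

lemma symmetric_mat_exists_max_eigenvalue:
  fixes A :: "real mat"
  assumes A: "A \<in> carrier_mat n n" and sym: "A\<^sup>T = A" and n: "0 < n"
  obtains k where "eigenvalue A k"
    "\<And>w. w \<in> carrier_vec n \<Longrightarrow> w \<bullet> (A *\<^sub>v w) \<le> k * (w \<bullet> w)"
proof -
  obtain v where v: "v \<in> carrier_vec n" and v1: "v \<bullet> v = 1"
    and max: "\<And>w. w \<in> carrier_vec n \<Longrightarrow> w \<bullet> w = 1 \<Longrightarrow> w \<bullet> (A *\<^sub>v w) \<le> v \<bullet> (A *\<^sub>v v)"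
    using quadratic_form_attains_max[OF A n] by blast
  define k where "k = v \<bullet> (A *\<^sub>v v)"
  have bound: "w \<bullet> (A *\<^sub>v w) \<le> k * (w \<bullet> w)" if w: "w \<in> carrier_vec n" for w
  proof (cases "w \<bullet> w = 0")
    case True
    then have "w = 0\<^sub>v n"
      using scalar_prod_self_eq_0[of w] w by auto
    then show ?thesis
      using A by simp
  next
    case False
    \<comment> \<open>Normalizing \<open>w\<close> multiplies the form by \<open>c * c\<close>;
      multiplying by \<open>w \<bullet> w\<close> afterwards undoes this.\<close>
    define c where "c = 1 / sqrt (w \<bullet> w)"
    have pos: "0 < w \<bullet> w"
      using False scalar_prod_self_nonneg[of w] by simp
    then have c: "c * c * (w \<bullet> w) = 1"
      by (simp add: c_def)
    then have "(c \<cdot>\<^sub>v w) \<bullet> (A *\<^sub>v (c \<cdot>\<^sub>v w)) \<le> k"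
      unfolding k_def using w by (intro max) (auto simp: mult.assoc)
    then have "c * c * (w \<bullet> (A *\<^sub>v w)) \<le> k"
      using A w by (simp add: mult_mat_vec mult.assoc)
    then have "c * c * (w \<bullet> (A *\<^sub>v w)) * (w \<bullet> w) \<le> k * (w \<bullet> w)"
      using pos by simp
    moreover have "c * c * (w \<bullet> (A *\<^sub>v w)) * (w \<bullet> w) = (c * c * (w \<bullet> w)) * (w \<bullet> (A *\<^sub>v w))"
      by (simp add: mult_ac)
    ultimately show ?thesis
      using c by simp
  qed
  define N where "N = mat_diag n (\<lambda>_. k) - A"
  have N: "N \<in> carrier_mat n n"
    unfolding N_def by (rule minus_carrier_mat[OF A])
  have Nsym: "N\<^sup>T = N"
  proof (rule eq_matI)
    fix i j assume ij: "i < dim_row N" "j < dim_col N"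
    then have "A $$ (j, i) = A $$ (i, j)"
      using A N sym index_transpose_mat(1)[of i A j] by auto
    then show "N\<^sup>T $$ (i, j) = N $$ (i, j)"
      using A N ij by (auto simp: N_def mat_diag_def)
  qed (use N in auto)
  have Nv: "N *\<^sub>v w = k \<cdot>\<^sub>v w - A *\<^sub>v w" if "w \<in> carrier_vec n" for w
  proof -
    have "mat_diag n (\<lambda>_. k) *\<^sub>v w = k \<cdot>\<^sub>v w"
      using that by (auto simp: mat_diag_mult_vec)
    then show ?thesis
      using A that by (simp add: N_def minus_mult_distrib_mat_vec[of _ n n])
  qed
  have Nq: "w \<bullet> (N *\<^sub>v w) = k * (w \<bullet> w) - w \<bullet> (A *\<^sub>v w)" if w: "w \<in> carrier_vec n" for w
    using A w by (simp add: Nv scalar_prod_minus_distrib[of _ n])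
  have "N *\<^sub>v v = 0\<^sub>v n"
    using Nq bound v1 by (intro psd_quadratic_form_eq_0[OF N Nsym _ v]) (auto simp: v k_def)
  then have Av: "A *\<^sub>v v = k \<cdot>\<^sub>v v"
  proof (intro eq_vecI)
    fix i assume "N *\<^sub>v v = 0\<^sub>v n" "i < dim_vec (k \<cdot>\<^sub>v v)"
    then have "i < n" "(N *\<^sub>v v) $ i = 0"
      using v by auto
    then show "(A *\<^sub>v v) $ i = (k \<cdot>\<^sub>v v) $ i"
      using A v by (simp add: Nv)
  qed (use A v in auto)
  have "v \<noteq> 0\<^sub>v n"
    using v1 by auto
  then have "eigenvector A v k"
    using A v Av by (simp add: eigenvector_def)
  then show thesis
    using that bound by (auto simp: eigenvalue_def)
qed

text \<open>The eigenvalue \<open>k\<close> that bounds the form is at most the maximum of the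
  finite spectrum, and raising \<open>k\<close> preserves the bound because
  \<open>w \<bullet> w\<close> is nonnegative.\<close>

lemma largest_eigenvalue:
  fixes A :: "real mat"
  assumes A: "A \<in> carrier_mat n n" and sym: "A\<^sup>T = A" and n: "0 < n"
  shows eigenvalue_largest_eigenvalue: "eigenvalue A (largest_eigenvalue A)"
    and quadratic_form_le_largest_eigenvalue:
      "w \<in> carrier_vec n \<Longrightarrow> w \<bullet> (A *\<^sub>v w) \<le> largest_eigenvalue A * (w \<bullet> w)"
proof -
  obtain k where k: "eigenvalue A k"
    and bound: "\<And>w. w \<in> carrier_vec n \<Longrightarrow> w \<bullet> (A *\<^sub>v w) \<le> k * (w \<bullet> w)"
    using symmetric_mat_exists_max_eigenvalue[OF A sym n] by blast
  have "k \<in> spectrum A"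
    using k by (simp add: spectrum_def)
  moreover note fin = card_finite_spectrum(1)[OF A]
  ultimately have "largest_eigenvalue A \<in> spectrum A" and le: "k \<le> largest_eigenvalue A"
    unfolding largest_eigenvalue_def by (auto intro: Max_in)
  then show "eigenvalue A (largest_eigenvalue A)"
    by (simp add: spectrum_def)
  assume "w \<in> carrier_vec n"
  then show "w \<bullet> (A *\<^sub>v w) \<le> largest_eigenvalue A * (w \<bullet> w)"
    using bound[of w] mult_right_mono[OF le scalar_prod_self_nonneg[of w]] by simp
qed

lemma uminus_mult_mat_vec:
  fixes A :: "'a :: comm_ring_1 mat"
  assumes "A \<in> carrier_mat n m" "v \<in> carrier_vec m"
  shows "(- A) *\<^sub>v v = - (A *\<^sub>v v)"
  using assms by (intro eq_vecI) auto

text \<open>Apply the maximal case to \<open>- A\<close>: the eigenvalue \<open>k\<close> obtained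
  there gives the eigenvalue \<open>- k\<close> of \<open>A\<close>, which the minimum of the
  spectrum does not exceed.\<close>

lemma smallest_eigenvalue_le_quadratic_form:
  fixes A :: "real mat"
  assumes A: "A \<in> carrier_mat n n" and sym: "A\<^sup>T = A" and w: "w \<in> carrier_vec n" and n: "0 < n"
  shows "smallest_eigenvalue A * (w \<bullet> w) \<le> w \<bullet> (A *\<^sub>v w)"
proof -
  have "- A \<in> carrier_mat n n" "(- A)\<^sup>T = - A"
    using A sym by (auto simp: transpose_uminus)
  then obtain k where k: "eigenvalue (- A) k"
    and bound: "\<And>w. w \<in> carrier_vec n \<Longrightarrow> w \<bullet> ((- A) *\<^sub>v w) \<le> k * (w \<bullet> w)"
    using symmetric_mat_exists_max_eigenvalue[OF _ _ n] by blast
  obtain v where v: "v \<in> carrier_vec n" "v \<noteq> 0\<^sub>v n" "(- A) *\<^sub>v v = k \<cdot>\<^sub>v v"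
    using k A by (auto simp: eigenvalue_def eigenvector_def)
  then have "- (A *\<^sub>v v) = k \<cdot>\<^sub>v v"
    using A by (simp add: uminus_mult_mat_vec)
  then have "A *\<^sub>v v = - (k \<cdot>\<^sub>v v)"
    by (metis uminus_uminus_vec)
  also have "\<dots> = (- k) \<cdot>\<^sub>v v"
    by (intro eq_vecI) auto
  finally have "- k \<in> spectrum A"
    using v A by (auto simp: spectrum_def eigenvalue_def eigenvector_def)
  then have "smallest_eigenvalue A \<le> - k"
    using card_finite_spectrum(1)[OF A] by (auto simp: smallest_eigenvalue_def)
  then have "smallest_eigenvalue A * (w \<bullet> w) \<le> - k * (w \<bullet> w)"
    by (rule mult_right_mono) (rule scalar_prod_self_nonneg)
  moreover have "w \<bullet> ((- A) *\<^sub>v w) = - (w \<bullet> (A *\<^sub>v w))"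
    using A w by (simp add: uminus_mult_mat_vec)
  ultimately show ?thesis
    using bound[OF w] by simp
qed

section \<open>Extreme eigenvalues of symmetric block matrices\<close>

lemma quadratic_form_four_block_mat:
  fixes A :: "'a :: comm_ring_1 mat"
  assumes A: "A \<in> carrier_mat n n" and B: "B \<in> carrier_mat n m" and D: "D \<in> carrier_mat m m"
    and x: "x \<in> carrier_vec n" and y: "y \<in> carrier_vec m"
  shows "(x @\<^sub>v y) \<bullet> (four_block_mat A B B\<^sup>T D *\<^sub>v (x @\<^sub>v y))
       = x \<bullet> (A *\<^sub>v x) + 2 * (x \<bullet> (B *\<^sub>v y)) + y \<bullet> (D *\<^sub>v y)"
proof -
  have BT: "B\<^sup>T \<in> carrier_mat m n"
    using B by simp
  have Ax: "A *\<^sub>v x \<in> carrier_vec n" and By: "B *\<^sub>v y \<in> carrier_vec n"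
    and Bx: "B\<^sup>T *\<^sub>v x \<in> carrier_vec m" and Dy: "D *\<^sub>v y \<in> carrier_vec m"
    using A B D x y by auto
  have "y \<bullet> (B\<^sup>T *\<^sub>v x) = x \<bullet> (B *\<^sub>v y)"
    using transpose_vec_mult_scalar[OF B y x] comm_scalar_prod[OF y Bx] by simp
  then show ?thesis
    using x y Ax By Bx Dy
    by (simp add: four_block_mat_mult_vec[OF A B BT D x y] scalar_prod_append[of _ n _ m]
        scalar_prod_add_distrib[of _ n] scalar_prod_add_distrib[of _ m])
qed

text \<open>If \<open>x @\<^sub>v y\<close> is an eigenvector for the largest eigenvalue and both parts are nonzero, then
  the smallest eigenvalue is bounded by the quadratic form at
  \<open>(y \<bullet> y) \<cdot>\<^sub>v x @\<^sub>v (- (x \<bullet> x)) \<cdot>\<^sub>v y\<close>; with these weights the off-diagonal terms cancel exactly.\<close>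

lemma four_block_mat_extreme_eigenvalues_le:
  fixes A :: "real mat"
  assumes A: "A \<in> carrier_mat n n" and B: "B \<in> carrier_mat n m" and D: "D \<in> carrier_mat m m"
    and symA: "A\<^sup>T = A" and symD: "D\<^sup>T = D" and n: "0 < n" and m: "0 < m"
    and boundA: "\<And>x. x \<in> carrier_vec n \<Longrightarrow> x \<bullet> (A *\<^sub>v x) \<le> a * (x \<bullet> x)"
    and boundD: "\<And>y. y \<in> carrier_vec m \<Longrightarrow> y \<bullet> (D *\<^sub>v y) \<le> d * (y \<bullet> y)"
  defines "M \<equiv> four_block_mat A B B\<^sup>T D"
  shows "largest_eigenvalue M + smallest_eigenvalue M \<le> a + d"
proof -
  define l s where "l = largest_eigenvalue M" and "s = smallest_eigenvalue M"
  have BT: "B\<^sup>T \<in> carrier_mat m n"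
    using B by simp
  have M: "M \<in> carrier_mat (n + m) (n + m)"
    using A D by (simp add: M_def)
  have symM: "M\<^sup>T = M"
    unfolding M_def using transpose_four_block_mat[OF A B BT D] by (simp add: symA symD)
  have nm: "0 < n + m"
    using n by simp
  \<comment> \<open>Kept general in \<open>x\<close> and \<open>y\<close>: each of the three cases
    below uses its own test vector.\<close>
  have s_le: "s * (x \<bullet> x + y \<bullet> y) \<le> x \<bullet> (A *\<^sub>v x) + 2 * (x \<bullet> (B *\<^sub>v y)) + y \<bullet> (D *\<^sub>v y)"
    if x: "x \<in> carrier_vec n" and y: "y \<in> carrier_vec m" for x y
    using smallest_eigenvalue_le_quadratic_form[OF M symM append_carrier_vec[OF x y] nm]
    unfolding M_def quadratic_form_four_block_mat[OF A B D x y] scalar_prod_append[OF x y x y]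
    by (simp add: s_def M_def)
  obtain v where v: "v \<in> carrier_vec (n + m)" "v \<noteq> 0\<^sub>v (n + m)" "M *\<^sub>v v = l \<cdot>\<^sub>v v"
    using eigenvalue_largest_eigenvalue[OF M symM nm] M
    by (auto simp: eigenvalue_def eigenvector_def l_def)
  define x y where "x = vec_first v n" and "y = vec_last v m"
  have x: "x \<in> carrier_vec n" and y: "y \<in> carrier_vec m" and vxy: "v = x @\<^sub>v y"
    using v by (auto simp: x_def y_def)
  have Ax: "A *\<^sub>v x \<in> carrier_vec n" and By: "B *\<^sub>v y \<in> carrier_vec n"
    and Bx: "B\<^sup>T *\<^sub>v x \<in> carrier_vec m" and Dy: "D *\<^sub>v y \<in> carrier_vec m"
    using A B D x y by auto
  define X Y b where "X = x \<bullet> x" and "Y = y \<bullet> y" and "b = x \<bullet> (B *\<^sub>v y)"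
  have "(A *\<^sub>v x + B *\<^sub>v y) @\<^sub>v (B\<^sup>T *\<^sub>v x + D *\<^sub>v y) = M *\<^sub>v v"
    unfolding M_def vxy by (rule four_block_mat_mult_vec[OF A B BT D x y, symmetric])
  also have "\<dots> = (l \<cdot>\<^sub>v x) @\<^sub>v (l \<cdot>\<^sub>v y)"
    using v by (intro eq_vecI) (auto simp: vxy)
  finally have "A *\<^sub>v x + B *\<^sub>v y = l \<cdot>\<^sub>v x" and "B\<^sup>T *\<^sub>v x + D *\<^sub>v y = l \<cdot>\<^sub>v y"
    using append_vec_eq[of "A *\<^sub>v x + B *\<^sub>v y" n "l \<cdot>\<^sub>v x"] x Ax By by auto
  \<comment> \<open>Pairing each block row of the eigenvalue equation with its own part of the
    vector leaves the same cross term \<open>b\<close> in both, since \<open>B\<^sup>T\<close> is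
    the adjoint of \<open>B\<close>.\<close>
  then have "x \<bullet> (A *\<^sub>v x + B *\<^sub>v y) = l * X" "y \<bullet> (B\<^sup>T *\<^sub>v x + D *\<^sub>v y) = l * Y"
    using x y by (simp_all add: X_def Y_def)
  moreover have "y \<bullet> (B\<^sup>T *\<^sub>v x) = b"
    using transpose_vec_mult_scalar[OF B y x] comm_scalar_prod[OF y Bx] by (simp add: b_def)
  ultimately have p: "x \<bullet> (A *\<^sub>v x) = l * X - b" and q: "y \<bullet> (D *\<^sub>v y) = l * Y - b"
    using scalar_prod_add_distrib[OF x Ax By] scalar_prod_add_distrib[OF y Bx Dy]
    by (simp_all add: b_def)
  have leX: "l * X - b \<le> a * X" and leY: "l * Y - b \<le> d * Y"
    using boundA[OF x] boundD[OF y] by (simp_all add: p q X_def Y_def)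
  have nonneg: "0 \<le> X" "0 \<le> Y"
    by (simp_all add: X_def Y_def scalar_prod_self_nonneg)
  consider (zero1) "X = 0" | (zero2) "Y = 0" | (pos) "0 < X" "0 < Y"
    using nonneg by linarith
  then have "l + s \<le> a + d"
  proof cases
    \<comment> \<open>The eigenvector lies in the second block, so \<open>D\<close> alone bounds
      \<open>l\<close>. A unit vector in the first block sees only \<open>A\<close> and bounds
      \<open>s\<close>.\<close>
    case zero1
    then have x0: "x = 0\<^sub>v n"
      using scalar_prod_self_eq_0[of x] x by (auto simp: X_def)
    have "Y \<noteq> 0"
      using scalar_prod_self_eq_0[of y] y v x0 by (auto simp: Y_def vxy)
    moreover have "b = 0"
      using x0 By by (simp add: b_def)
    ultimately have "l \<le> d"
      using leY nonneg by simp
    moreover have "s \<le> a"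
      using s_le[of "unit_vec n 0" "0\<^sub>v m"] boundA[of "unit_vec n 0"] B D n
      by (simp add: scalar_prod_left_unit)
    ultimately show ?thesis by simp
  next
    \<comment> \<open>The mirror image: \<open>A\<close> bounds \<open>l\<close>, and a unit vector
      in the second block bounds \<open>s\<close> through \<open>D\<close>.\<close>
    case zero2
    then have y0: "y = 0\<^sub>v m"
      using scalar_prod_self_eq_0[of y] y by (auto simp: Y_def)
    have "X \<noteq> 0"
      using scalar_prod_self_eq_0[of x] x v y0 by (auto simp: X_def vxy)
    moreover have "B *\<^sub>v 0\<^sub>v m = 0\<^sub>v n"
      using B by (intro eq_vecI) auto
    then have "b = 0"
      using y0 x by (simp add: b_def)
    ultimately have "l \<le> a"
      using leX nonneg by simp
    moreover have "s \<le> d"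
      using s_le[of "0\<^sub>v n" "unit_vec m 0"] boundD[of "unit_vec m 0"] A B m
      by (simp add: scalar_prod_left_unit)
    ultimately show ?thesis by simp
  next
    case pos
    have "s * (Y * (Y * X) + X * (X * Y)) \<le> Y * (Y * (l * X - b)) - 2 * (X * (Y * b)) + X * (X * (l * Y - b))"
      using s_le[of "Y \<cdot>\<^sub>v x" "(- X) \<cdot>\<^sub>v y"] x y Ax By Dy A B D
      by (simp add: mult_mat_vec p q flip: X_def Y_def b_def)
    \<comment> \<open>The squared length of the test vector is \<open>X * Y * (X + Y)\<close>, and
      the terms in \<open>b\<close> combine to \<open>- b * (X + Y) * (X + Y)\<close>, so the
      positive factor \<open>X + Y\<close> can be cancelled.\<close>
    then have "(s * (X * Y)) * (X + Y) \<le> (l * (X * Y) - b * (X + Y)) * (X + Y)"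
      by (simp add: algebra_simps)
    then have "s * (X * Y) \<le> l * (X * Y) - b * (X + Y)"
      using pos by (simp add: mult_le_cancel_right)
    \<comment> \<open>Weighting the two block bounds by \<open>Y\<close> and \<open>X\<close>
      produces the same \<open>- b * (X + Y)\<close>, so adding \<open>l * (X * Y)\<close> to the
      previous inequality eliminates \<open>b\<close>.\<close>
    moreover have "(l * X - b) * Y + (l * Y - b) * X \<le> a * X * Y + d * Y * X"
      using leX leY nonneg by (intro add_mono mult_right_mono)
    ultimately have "(l + s) * (X * Y) \<le> (a + d) * (X * Y)"
      by (simp add: algebra_simps)
    then show ?thesis
      using pos by (simp add: mult_le_cancel_right zero_less_mult_iff)
  qed
  then show ?thesis
    by (simp add: l_def s_def)
qed

section \<open>Adding a diagonal matrix\<close>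

lemma quadratic_form_mat_diag_le:
  fixes f :: "nat \<Rightarrow> real"
  assumes v: "v \<in> carrier_vec n" and "\<And>i. i < n \<Longrightarrow> f i \<le> c"
  shows "v \<bullet> (mat_diag n f *\<^sub>v v) \<le> c * (v \<bullet> v)"
proof -
  have "v $ i * (f i * v $ i) \<le> c * (v $ i * v $ i)" if "i < n" for i
    using mult_right_mono[OF assms(2)[OF that], of "v $ i * v $ i"] by (simp add: mult_ac)
  then show ?thesis
    unfolding mat_diag_mult_vec[OF v] using v
    by (auto simp: scalar_prod_def sum_distrib_left intro!: sum_mono)
qed

text \<open>Supplies the bounds on the diagonal blocks. A bound on the form is all that the block
  estimate asks for, so the largest eigenvalue of the sum never has to be computed.\<close>

lemma quadratic_form_add_mat_diag_le:
  fixes A :: "real mat"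
  assumes A: "A \<in> carrier_mat n n" and sym: "A\<^sup>T = A" and v: "v \<in> carrier_vec n" and n: "0 < n"
    and f: "\<And>i. i < n \<Longrightarrow> f i \<le> c"
  shows "v \<bullet> ((A + mat_diag n f) *\<^sub>v v) \<le> (largest_eigenvalue A + c) * (v \<bullet> v)"
proof -
  have "v \<bullet> ((A + mat_diag n f) *\<^sub>v v) = v \<bullet> (A *\<^sub>v v) + v \<bullet> (mat_diag n f *\<^sub>v v)"
    using A v
    by (simp add: add_mult_distrib_mat_vec[of _ n n] scalar_prod_add_distrib[of _ n]
        mult_mat_vec_carrier[of _ n n])
  then show ?thesis
    using quadratic_form_le_largest_eigenvalue[OF A sym n v] quadratic_form_mat_diag_le[OF v, of f c] f
    by (simp add: algebra_simps)
qed

lemma transpose_mat_diag: "(mat_diag n f)\<^sup>T = mat_diag n f"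
  by (intro eq_matI) (auto simp: mat_diag_def)

section \<open>The matrices of a mixed graph\<close>

lemma signless_laplacian_carrier:
  "signless_laplacian G vs \<in> carrier_mat (length vs) (length vs)"
  by (simp add: signless_laplacian_def degree_mat_def adjacency_mat_def)

lemma transpose_signless_laplacian: "(signless_laplacian G vs)\<^sup>T = signless_laplacian G vs"
proof -
  have commute: "Upair (vs ! j) (vs ! i) = Upair (vs ! i) (vs ! j)" for i j
    by simp
  have "(adjacency_mat G vs)\<^sup>T = adjacency_mat G vs"
    by (intro eq_matI) (auto simp: adjacency_mat_def commute)
  moreover have "degree_mat G vs \<in> carrier_mat (length vs) (length vs)"
    "adjacency_mat G vs \<in> carrier_mat (length vs) (length vs)"
    by (simp_all add: degree_mat_def adjacency_mat_def)
  ultimately show ?thesis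
    by (simp add: signless_laplacian_def transpose_add[of _ "length vs" "length vs"]
        degree_mat_def transpose_mat_diag)
qed

lemma signless_laplacian_undirected_part:
  "signless_laplacian (undirected_part G) vs = signless_laplacian G vs"
  by (simp add: signless_laplacian_def degree_mat_def adjacency_mat_def deg_def
      undirected_part_def multigraph.truncate_def)

text \<open>The undirected degrees in the integrated degree matrix join the adjacency blocks to form
  the signless Laplacian, so only the arc degrees remain as diagonal perturbations.\<close>

lemma integrated_signless_laplacian_eq_four_block_mat:
  fixes vs :: "'v list"
  defines "n \<equiv> length vs"
  shows "integrated_signless_laplacian G vs = four_block_mat
    (signless_laplacian G vs + mat_diag n (\<lambda>i. real (out_deg G (vs ! i)))) (arc_mat G vs)
    (arc_mat G vs)\<^sup>T (signless_laplacian G vs + mat_diag n (\<lambda>i. real (in_deg G (vs ! i))))"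
  by (intro eq_matI)
    (auto simp: n_def integrated_signless_laplacian_def integrated_degree_mat_def Let_def
      integrated_adjacency_mat_def signless_laplacian_def degree_mat_def adjacency_mat_def
      arc_mat_def mat_diag_def)

theorem theorem4p15:
  fixes G :: "'v mixed_graph" and vs :: "'v list"
  assumes "simple_mixed_graph G"
    and "verts G \<noteq> {}"
    and "distinct vs" and "set vs = verts G"
  shows "largest_eigenvalue (integrated_signless_laplacian G vs)
         + smallest_eigenvalue (integrated_signless_laplacian G vs)
       \<le> 2 * largest_eigenvalue (signless_laplacian (undirected_part G) vs)
         + real (Max (out_deg G ` verts G)) + real (Max (in_deg G ` verts G))"
proof -
  define n Q where "n = length vs" and "Q = signless_laplacian G vs"
  define out_d in_d where "out_d = real (Max (out_deg G ` verts G))"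
    and "in_d = real (Max (in_deg G ` verts G))"
  have fin: "finite (verts G)"
    using assms(4) by (metis List.finite_set)
  have mem: "vs ! i \<in> verts G" if "i < n" for i
    using that assms(4) by (auto simp: n_def)
  have n: "0 < n"
    using assms(2,4) by (auto simp: n_def)
  have Q: "Q \<in> carrier_mat n n" and symQ: "Q\<^sup>T = Q"
    by (simp_all add: Q_def n_def signless_laplacian_carrier transpose_signless_laplacian)
  have out_le: "real (out_deg G (vs ! i)) \<le> out_d" and in_le: "real (in_deg G (vs ! i)) \<le> in_d"
    if "i < n" for i
    using fin mem[OF that] n by (auto simp: out_d_def in_d_def)
  have "(Q + mat_diag n f)\<^sup>T = Q + mat_diag n f" for f
    by (simp add: transpose_add[OF Q] symQ transpose_mat_diag)
  moreover have "Q + mat_diag n f \<in> carrier_mat n n" for f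
    by simp
  moreover have "arc_mat G vs \<in> carrier_mat n n"
    by (simp add: arc_mat_def n_def)
  \<comment> \<open>Both diagonal blocks perturb the same \<open>Q\<close>, which accounts for the
    factor 2; the maximal out-degree and in-degree enter through one block each.\<close>
  ultimately have "largest_eigenvalue (integrated_signless_laplacian G vs)
        + smallest_eigenvalue (integrated_signless_laplacian G vs)
      \<le> (largest_eigenvalue Q + out_d) + (largest_eigenvalue Q + in_d)"
    unfolding integrated_signless_laplacian_eq_four_block_mat Q_def[symmetric] n_def[symmetric]
    by (intro four_block_mat_extreme_eigenvalues_le[where n = n and m = n]
        quadratic_form_add_mat_diag_le[OF Q symQ] n out_le in_le)
  then show ?thesis
    by (simp add: signless_laplacian_undirected_part Q_def out_d_def in_d_def)
qed

end
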